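(* AIXI is not computable for any universal Turing machine $U$; that is, for every universal Turing machine $U$ with associated Bayesian mixture $\xi_U$, no $\xi_U$-optimal deterministic policy is computable.
   Context: The action set $\mathcal{A}$ is finite with at least two elements and the percept set $\mathcal{E}$ is finite; a percept is $e=(o,r)$ with reward $r\in[0,1]$, and there are percepts with reward $0$ and percepts with reward $1$. A history is $\ae_{<t}=a_1e_1\ldots a_{t-1}e_{t-1}\in(\mathcal{A}\times\mathcal{E})^*$. Policies are deterministic maps from histories to actions. A chronological contextual semimeasure $\nu$ assigns to all equal-length $e_{1:t}\in\mathcal{E}^t$, $a_{1:t}\in\mathcal{A}^t$ a number $\nu(e_{1:t}\,\|\,a_{1:t})\in[0,1]$ with $\nu(\epsilon\,\|\,\epsilon)\le1$ and $\sum_{e_t\in\mathcal{E}}\nu(e_{1:t}\,\|\,a_{1:t})\le\nu(e_{<t}\,\|\,a_{<t})$. A (chronological) monotone machine $T$ takes a binary program $p$ and an action sequence on a separate input tape and outputs percepts on a one-way output tape, the first $t$ percepts depending only on $p$ and $a_{1:t}$. $U$ is universal if it can simulate every such machine $T$: there is a binary string $q_T$ with $U(q_Tp,a)=T(p,a)$ for all $p,a$. The associated mixture is $\xi_U(e_{<t}\,\|\,a_{<t}):=\sum_{p:\,e_{<t}\sqsubseteq U(p,a_{<t})}2^{-|p|}$, where $\sqsubseteq$ means ``is a prefix of'' and, as usual for monotone machines, the sum is over the minimal such programs $p$. Equivalently, $\xi_U$ is a mixture $\sum_\nu w(\nu)\nu$ over all lower semicomputable chronological contextual semimeasures with all weights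 $w(\nu)>0$. The discount function $\gamma:\mathbb{N}\to\mathbb{R}_{\ge0}$ is computable and summable with $\Gamma_t:=\sum_{k\ge t}\gamma_k>0$ for all $t$. The value of $\pi$ in $\nu$ is $$V^\pi_\nu(\ae_{<t})=\frac1{\Gamma_t}\sum_{k=t}^\infty\gamma_k\sum_{e_{t:k}}r_k\,\frac{\nu(e_{1:k}\,\|\,a_{1:k})}{\nu(e_{<t}\,\|\,a_{<t})},\qquad a_i:=\pi(\ae_{<i})\text{ for }i\ge t,$$ $V^*_\nu:=\sup_\pi V^\pi_\nu$, and $\pi$ is $\nu$-optimal if $V^\pi_\nu(\ae_{<t})=V^*_\nu(\ae_{<t})$ for all histories. AIXI denotes a $\xi_U$-optimal policy. *)

theory Defs
  imports "HOL-Analysis.Analysis" "HOL-Library.Sublist"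
begin

text \<open>Work tapes are two-way infinite and are stored relative to the head: cell \<open>0\<close> is the one
  being scanned. Every machine uses only a finite set of cell contents; the symbols
  \<open>Aux 0, Aux 1, \<dots>\<close> are a supply of auxiliary symbols besides the blank and the input/output
  symbols \<open>'s\<close>.\<close>

datatype 's cell = Blank | Sym 's | Aux nat

datatype move = MoveL | Stay | MoveR

type_synonym 's tape = "int \<Rightarrow> 's cell"

fun write_move :: "'s cell \<times> move \<Rightarrow> 's tape \<Rightarrow> 's tape" where
  "write_move (c, MoveL) t = (\<lambda>i. (t(0 := c)) (i - 1))"
| "write_move (c, Stay) t = t(0 := c)"
| "write_move (c, MoveR) t = (\<lambda>i. (t(0 := c)) (i + 1))"

definition input_tape :: "'s list \<Rightarrow> 's tape" where
  "input_tape x = (\<lambda>i. if 0 \<le> i \<and> i < int (length x) then Sym (x ! nat i) else Blank)"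

text \<open>States are \<open>0, \<dots>, tm_states - 1\<close>, with initial state \<open>0\<close>; \<open>None\<close> means that the machine halts.
  The values of \<open>tm_delta\<close> outside the finite set of states and symbols are irrelevant, so the
  program of a well-formed machine is a finite table.\<close>

record 's tm =
  tm_states :: nat
  tm_alphabet :: "'s cell set"
  tm_delta :: "nat \<Rightarrow> 's cell \<Rightarrow> (nat \<times> 's cell \<times> move) option"

definition wf_tm :: "'s tm \<Rightarrow> bool" where
  "wf_tm M \<longleftrightarrow> 0 < tm_states M \<and> finite (tm_alphabet M) \<and> Blank \<in> tm_alphabet M \<and>
     (\<forall>q < tm_states M. \<forall>c \<in> tm_alphabet M.
        (case tm_delta M q c of
           None \<Rightarrow> True
         | Some (q', c', d) \<Rightarrow> q' < tm_states M \<and> c' \<in> tm_alphabet M))"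

fun tm_step :: "'s tm \<Rightarrow> nat \<times> 's tape \<Rightarrow> nat \<times> 's tape" where
  "tm_step M (q, t) =
     (case tm_delta M q (t 0) of
        None \<Rightarrow> (q, t)
      | Some (q', c, d) \<Rightarrow> (q', write_move (c, d) t))"

text \<open>The result of a halting computation is the word that starts at the head and is terminated by
  a blank; whatever else is left on the tape is ignored.\<close>

definition tm_computes :: "'s tm \<Rightarrow> 's list \<Rightarrow> 's list \<Rightarrow> bool" where
  "tm_computes M x y \<longleftrightarrow>
     (\<exists>n q t. (tm_step M ^^ n) (0, input_tape x) = (q, t) \<and> tm_delta M q (t 0) = None \<and>
        (\<forall>i < length y. t (int i) = Sym (y ! i)) \<and> t (int (length y)) = Blank)"

definition turing_computable_on ::
  "'x set \<Rightarrow> ('x \<Rightarrow> 's list) \<Rightarrow> ('y \<Rightarrow> 's list) \<Rightarrow> ('x \<Rightarrow> 'y) \<Rightarrow> bool" where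
  "turing_computable_on X enc_in enc_out f \<longleftrightarrow>
     (\<exists>M. wf_tm M \<and> (\<forall>x\<in>X. Sym ` set (enc_in x) \<subseteq> tm_alphabet M \<and>
                          tm_computes M (enc_in x) (enc_out (f x))))"

text \<open>Computable sequences of reals: uniformly approximable by a computable rational-valued function.
  Numbers are written in unary.\<close>

datatype num_symbol = Stroke | Separator | Minus

definition code_nat_pair :: "nat \<times> nat \<Rightarrow> num_symbol list" where
  "code_nat_pair = (\<lambda>(n, k). replicate n Stroke @ [Separator] @ replicate k Stroke)"

definition code_rat :: "rat \<Rightarrow> num_symbol list" where
  "code_rat x = (let (a, b) = quotient_of x in
     (if a < 0 then [Minus] else []) @ replicate (nat \<bar>a\<bar>) Stroke @ [Separator] @ replicate (nat b) Stroke)"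

definition computable_real_seq :: "(nat \<Rightarrow> real) \<Rightarrow> bool" where
  "computable_real_seq g \<longleftrightarrow>
     (\<exists>\<phi> :: nat \<times> nat \<Rightarrow> rat. turing_computable_on UNIV code_nat_pair code_rat \<phi> \<and>
        (\<forall>n k. \<bar>g n - of_rat (\<phi> (n, k))\<bar> < 1 / (real k + 1)))"

text \<open>A monotone machine has finitely many work tapes, a one-way read-only program tape of bits, a
  one-way read-only tape of actions, and a one-way write-only tape of percepts. \<open>ReadBit\<close> and
  \<open>ReadAct\<close> consume the next symbol of the respective input tape and branch on it; \<open>Emit\<close> appends a
  percept to the output.\<close>

datatype ('a, 'e) instr =
    Halt
  | Work "(('a + 'e) cell \<times> move) list" nat
  | ReadBit "bool \<Rightarrow> nat"
  | ReadAct "'a \<Rightarrow> nat"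
  | Emit 'e nat

record ('a, 'e) machine =
  mm_tapes :: nat
  mm_states :: nat
  mm_alphabet :: "('a + 'e) cell set"
  mm_delta :: "nat \<Rightarrow> ('a + 'e) cell list \<Rightarrow> ('a, 'e) instr"

definition wf_machine :: "'e set \<Rightarrow> ('a, 'e) machine \<Rightarrow> bool" where
  "wf_machine E M \<longleftrightarrow> 0 < mm_states M \<and> finite (mm_alphabet M) \<and> Blank \<in> mm_alphabet M \<and>
     (\<forall>q < mm_states M. \<forall>cs. length cs = mm_tapes M \<and> set cs \<subseteq> mm_alphabet M \<longrightarrow>
        (case mm_delta M q cs of
           Halt \<Rightarrow> True
         | Work ws q' \<Rightarrow> length ws = mm_tapes M \<and> fst ` set ws \<subseteq> mm_alphabet M \<and> q' < mm_states M
         | ReadBit f \<Rightarrow> (\<forall>b. f b < mm_states M)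
         | ReadAct f \<Rightarrow> (\<forall>a. f a < mm_states M)
         | Emit e q' \<Rightarrow> e \<in> E \<and> q' < mm_states M))"

record ('a, 'e) mm_config =
  mc_state :: nat
  mc_program :: "bool list"
  mc_actions :: "'a list"
  mc_tapes :: "('a + 'e) tape list"
  mc_output :: "'e list"

text \<open>\<open>mc_program\<close> and \<open>mc_actions\<close> are the unread parts of the input tapes. A machine that wants to
  read beyond the end of the given finite inputs is blocked; it cannot detect that end. Thus
  the output on a finite program is what the machine prints, reading no further, on every
  extension of that program.\<close>

definition mm_step :: "('a, 'e) machine \<Rightarrow> ('a, 'e) mm_config \<Rightarrow> ('a, 'e) mm_config" where
  "mm_step M c =
     (case mm_delta M (mc_state c) (map (\<lambda>t. t 0) (mc_tapes c)) of
        Halt \<Rightarrow> c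
      | Work ws q \<Rightarrow> c\<lparr>mc_state := q, mc_tapes := map2 write_move ws (mc_tapes c)\<rparr>
      | ReadBit f \<Rightarrow>
          (case mc_program c of [] \<Rightarrow> c | b # p \<Rightarrow> c\<lparr>mc_state := f b, mc_program := p\<rparr>)
      | ReadAct f \<Rightarrow>
          (case mc_actions c of [] \<Rightarrow> c | a # as \<Rightarrow> c\<lparr>mc_state := f a, mc_actions := as\<rparr>)
      | Emit e q \<Rightarrow> c\<lparr>mc_state := q, mc_output := mc_output c @ [e]\<rparr>)"

definition mm_init :: "('a, 'e) machine \<Rightarrow> bool list \<Rightarrow> 'a list \<Rightarrow> ('a, 'e) mm_config" where
  "mm_init M p as =
     \<lparr>mc_state = 0, mc_program = p, mc_actions = as,
      mc_tapes = replicate (mm_tapes M) (\<lambda>_. Blank), mc_output = []\<rparr>"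

definition printed :: "('a, 'e) machine \<Rightarrow> bool list \<Rightarrow> 'a list \<Rightarrow> nat \<Rightarrow> 'e list" where
  "printed M p as n = mc_output ((mm_step M ^^ n) (mm_init M p as))"

text \<open>\<open>T(p,a)\<close> as a finite or infinite sequence: its \<open>i\<close>-th entry (counted from \<open>0\<close>) is \<open>None\<close> if
  fewer than \<open>i + 1\<close> percepts are ever printed.\<close>

definition machine_output :: "('a, 'e) machine \<Rightarrow> bool list \<Rightarrow> 'a list \<Rightarrow> nat \<Rightarrow> 'e option" where
  "machine_output M p as i =
     (if \<exists>n. i < length (printed M p as n)
      then Some (printed M p as (LEAST n. i < length (printed M p as n)) ! i)
      else None)"

definition prefix_of_output :: "'e list \<Rightarrow> (nat \<Rightarrow> 'e option) \<Rightarrow> bool" (infix "\<sqsubseteq>\<^sub>o" 50) where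
  "es \<sqsubseteq>\<^sub>o x \<longleftrightarrow> (\<forall>i < length es. x i = Some (es ! i))"

definition chronological_machine :: "'e set \<Rightarrow> ('a, 'e) machine \<Rightarrow> bool" where
  "chronological_machine E M \<longleftrightarrow> wf_machine E M \<and>
     (\<forall>p as t. \<forall>i < t. machine_output M p as i = machine_output M p (take t as) i)"

definition universal_machine :: "'e set \<Rightarrow> ('a, 'e) machine \<Rightarrow> bool" where
  "universal_machine E U \<longleftrightarrow> chronological_machine E U \<and>
     (\<forall>T. chronological_machine E T \<longrightarrow>
        (\<exists>q. \<forall>p as. machine_output U (q @ p) as = machine_output T p as))"

definition minimal_programs :: "('a, 'e) machine \<Rightarrow> 'e list \<Rightarrow> 'a list \<Rightarrow> bool list set" where
  "minimal_programs U es as =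
     {p. es \<sqsubseteq>\<^sub>o machine_output U p as \<and>
         \<not> (\<exists>p'. strict_prefix p' p \<and> es \<sqsubseteq>\<^sub>o machine_output U p' as)}"

text \<open>\<open>mixture U es as\<close> is \<open>\<xi>\<^sub>U(es \<parallel> as)\<close>. The minimal programs form a prefix-free set, so by Kraft's
  inequality the sum converges.\<close>

definition mixture :: "('a, 'e) machine \<Rightarrow> 'e list \<Rightarrow> 'a list \<Rightarrow> real" where
  "mixture U es as = (\<Sum>\<^sub>\<infinity>p \<in> minimal_programs U es as. 1 / 2 ^ length p)"

type_synonym 'o percept = "'o \<times> real"
type_synonym ('a, 'o) history = "('a \<times> 'o percept) list"
type_synonym ('a, 'o) policy = "('a, 'o) history \<Rightarrow> 'a"
type_synonym ('a, 'o) environment = "'o percept list \<Rightarrow> 'a list \<Rightarrow> real"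

definition histories :: "'o percept set \<Rightarrow> ('a, 'o) history set" where
  "histories E = {h. snd ` set h \<subseteq> E}"

definition code_history :: "('a, 'o) history \<Rightarrow> ('a + 'o percept) list" where
  "code_history h = concat (map (\<lambda>(a, e). [Inl a, Inr e]) h)"

definition computable_policy :: "'o percept set \<Rightarrow> ('a, 'o) policy \<Rightarrow> bool" where
  "computable_policy E \<pi> \<longleftrightarrow>
     turing_computable_on (histories E) code_history (\<lambda>a. [Inl a]) \<pi>"

definition discount_tail :: "(nat \<Rightarrow> real) \<Rightarrow> nat \<Rightarrow> real" where
  "discount_tail \<gamma> t = (\<Sum>k. \<gamma> (t + k))"

text \<open>The actions that \<open>\<pi>\<close> takes from history \<open>h\<close> on while the percepts \<open>es\<close> arrive.\<close>

fun policy_actions :: "('a, 'o) policy \<Rightarrow> ('a, 'o) history \<Rightarrow> 'o percept list \<Rightarrow> 'a list" where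
  "policy_actions \<pi> h [] = []"
| "policy_actions \<pi> h (e # es) = \<pi> h # policy_actions \<pi> (h @ [(\<pi> h, e)]) es"

text \<open>Time steps are counted from \<open>1\<close>, so a history \<open>h\<close> of length \<open>t - 1\<close> is followed by step \<open>t\<close>.
  In the outer sum \<open>j\<close> stands for \<open>k - t\<close>, and \<open>es\<close> for the percepts \<open>e\<^sub>t, \<dots>, e\<^sub>k\<close>.\<close>

definition policy_value ::
  "'o percept set \<Rightarrow> (nat \<Rightarrow> real) \<Rightarrow> ('a, 'o) environment \<Rightarrow> ('a, 'o) policy \<Rightarrow> ('a, 'o) history \<Rightarrow> real"
where
  "policy_value E \<gamma> \<nu> \<pi> h = (let t = length h + 1 in
     1 / discount_tail \<gamma> t *
       (\<Sum>j. \<gamma> (t + j) *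
          (\<Sum>es | set es \<subseteq> E \<and> length es = j + 1.
             snd (last es) *
               (\<nu> (map snd h @ es) (map fst h @ policy_actions \<pi> h es) / \<nu> (map snd h) (map fst h)))))"

definition optimal_value ::
  "'o percept set \<Rightarrow> (nat \<Rightarrow> real) \<Rightarrow> ('a, 'o) environment \<Rightarrow> ('a, 'o) history \<Rightarrow> real"
where
  "optimal_value E \<gamma> \<nu> h = (SUP \<pi>. policy_value E \<gamma> \<nu> \<pi> h)"

definition optimal_policy ::
  "'o percept set \<Rightarrow> (nat \<Rightarrow> real) \<Rightarrow> ('a, 'o) environment \<Rightarrow> ('a, 'o) policy \<Rightarrow> bool"
where
  "optimal_policy E \<gamma> \<nu> \<pi> \<longleftrightarrow>
     (\<forall>h \<in> histories E. policy_value E \<gamma> \<nu> \<pi> h = optimal_value E \<gamma> \<nu> h)"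

definition AIXI ::
  "'o percept set \<Rightarrow> (nat \<Rightarrow> real) \<Rightarrow> ('a, 'o percept) machine \<Rightarrow> ('a, 'o) policy \<Rightarrow> bool"
where
  "AIXI E \<gamma> U \<pi> \<longleftrightarrow> optimal_policy E \<gamma> (mixture U) \<pi>"

end

theory Submission
  imports Defs
begin

text \<open>Suppose that \<open>\<pi>\<close> is \<open>\<xi>\<^sub>U\<close>-optimal and computable. Consider the environment that pays reward
  \<open>0\<close> as long as the agent acts like \<open>\<pi>\<close> and reward \<open>1\<close> forever after its first deviation. As \<open>\<pi>\<close> is
  computable, a monotone machine produces this environment without reading its program tape, so
  \<open>\<xi>\<^sub>U\<close> dominates it with a factor \<open>w > 0\<close>. Along the history of \<open>\<pi>\<close>, \<open>\<xi>\<^sub>U\<close> decreases to a limit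
  \<open>L \<ge> w\<close>. After \<open>t\<close> steps of it \<open>\<pi>\<close> has value at most \<open>1 - L / \<xi>\<^sub>U\<close>, since all further rewards are \<open>0\<close>
  with posterior probability at least \<open>L / \<xi>\<^sub>U\<close>, whereas a deviation has value at least \<open>w / \<xi>\<^sub>U\<close>. Thus
  optimality gives \<open>w + L \<le> \<xi>\<^sub>U\<close> for all \<open>t\<close>, which contradicts \<open>\<xi>\<^sub>U \<rightarrow> L\<close>.\<close>

section \<open>Mixtures as limits of finite frequencies\<close>

lemma prefix_mm_step_output: "prefix (mc_output c) (mc_output (mm_step M c))"
  by (auto simp: mm_step_def split: instr.split list.split)

lemma prefix_printed: "m \<le> n \<Longrightarrow> prefix (printed M p as m) (printed M p as n)"
  by (induction n rule: dec_induct)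
     (auto simp: printed_def intro: prefix_order.trans[OF _ prefix_mm_step_output])

lemma prefix_nth: "prefix xs ys \<Longrightarrow> i < length xs \<Longrightarrow> ys ! i = xs ! i"
  by (auto simp: prefix_def nth_append)

text \<open>Printed percepts are never revised, so any time at which entry \<open>i\<close> exists
  may replace the \<open>LEAST\<close> one.\<close>

lemma machine_output_eq_Some_iff:
  "machine_output M p as i = Some e \<longleftrightarrow>
     (\<exists>n. i < length (printed M p as n) \<and> printed M p as n ! i = e)"
proof -
  let ?P = "\<lambda>n. i < length (printed M p as n)"
  have least: "printed M p as (LEAST n. ?P n) ! i = printed M p as n ! i" if n: "?P n" for n
    using prefix_nth[OF prefix_printed[OF Least_le[of ?P, OF n]] LeastI[of ?P, OF n]] by simp
  show ?thesis
    unfolding machine_output_def using least by (auto; metis)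
qed

lemma machine_output_append_program:
  assumes "machine_output M p as i = Some e"
  shows "machine_output M (p @ r) as i = Some e"
proof -
  have sim: "\<exists>m. (mm_step M ^^ m) (mm_init M (p @ r) as) =
           (let c = (mm_step M ^^ n) (mm_init M p as) in c\<lparr>mc_program := mc_program c @ r\<rparr>)" for n
  proof (induction n)
    case 0
    show ?case by (rule exI[of _ 0]) (simp add: mm_init_def)
  next
    case (Suc n)
    define c where "c = (mm_step M ^^ n) (mm_init M p as)"
    from Suc obtain m where
      m: "(mm_step M ^^ m) (mm_init M (p @ r) as) = c\<lparr>mc_program := mc_program c @ r\<rparr>"
      by (auto simp: c_def Let_def)
    show ?case
    \<comment> \<open>A stationary run may be blocked at the end of \<open>p\<close>. The run on
      \<open>p @ r\<close> would read on there, so it is held back and makes no step.\<close>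
    proof (cases "mm_step M c = c")
      case True
      then show ?thesis using m by (intro exI[of _ m]) (simp add: c_def Let_def)
    next
      case False
      then have "mm_step M (c\<lparr>mc_program := mc_program c @ r\<rparr>) =
          (mm_step M c)\<lparr>mc_program := mc_program (mm_step M c) @ r\<rparr>"
        by (cases c) (auto simp: mm_step_def split: instr.splits list.splits)
      then show ?thesis using m by (intro exI[of _ "Suc m"]) (simp add: c_def Let_def)
    qed
  qed
  from assms obtain n where n: "i < length (printed M p as n)" "printed M p as n ! i = e"
    by (auto simp: machine_output_eq_Some_iff)
  from sim[of n] obtain m where
    "(mm_step M ^^ m) (mm_init M (p @ r) as) =
       (let c = (mm_step M ^^ n) (mm_init M p as) in c\<lparr>mc_program := mc_program c @ r\<rparr>)" ..
  then have "printed M (p @ r) as m = printed M p as n"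
    by (simp add: printed_def Let_def)
  with n show ?thesis by (auto simp: machine_output_eq_Some_iff intro!: exI[of _ m])
qed

lemma prefix_of_output_append_program:
  "es \<sqsubseteq>\<^sub>o machine_output M p as \<Longrightarrow> es \<sqsubseteq>\<^sub>o machine_output M (p @ r) as"
  by (auto simp: prefix_of_output_def intro: machine_output_append_program)

section \<open>Densities of programs of a fixed length\<close>

text \<open>The words counted on the left are partitioned by their shortest prefix with
  \<open>Q\<close>; such a prefix \<open>p\<close> has \<open>2 ^ (n - length p)\<close> extensions
  of length \<open>n\<close>.\<close>

lemma card_extensions_eq_sum_minimal:
  assumes "\<And>p r. Q p \<Longrightarrow> Q (p @ r)"
  defines "minimal \<equiv> {p :: bool list. Q p \<and> \<not> (\<exists>p'. strict_prefix p' p \<and> Q p')}"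
  shows "real (card {w. length w = n \<and> Q w}) / 2 ^ n =
           (\<Sum>p | p \<in> minimal \<and> length p \<le> n. 1 / 2 ^ length p)"
proof -
  let ?M = "{p. p \<in> minimal \<and> length p \<le> n}"
  let ?ext = "\<lambda>p. (@) p ` {r. length r = n - length p}"
  have fin: "finite ?M"
    by (rule finite_subset[OF _ finite_lists_length_le[of "UNIV :: bool set" n]]) auto
  have len: "card {r :: bool list. length r = k} = 2 ^ k" "finite {r :: bool list. length r = k}" for k
    using card_lists_length_eq[of "UNIV :: bool set" k] finite_lists_length_eq[of "UNIV :: bool set" k]
    by auto
  have shortest: "\<exists>p r. w = p @ r \<and> p \<in> minimal" if "Q w" for w
    using that
  proof (induction "length w" arbitrary: w rule: less_induct)
    case less
    show ?case
    proof (cases "w \<in> minimal")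
      case False
      then obtain p' where p': "strict_prefix p' w" "Q p'"
        using less.prems by (auto simp: minimal_def)
      then obtain p r where "p' = p @ r" "p \<in> minimal"
        using less.hyps[of p'] prefix_length_less by blast
      then show ?thesis using p' by (auto simp: strict_prefix_def prefix_def)
    qed force
  qed
  have "{w. length w = n \<and> Q w} = (\<Union>p\<in>?M. ?ext p)"
    using shortest assms(1) by (fastforce simp: minimal_def)
  also have "card \<dots> = (\<Sum>p\<in>?M. card (?ext p))"
  proof (rule card_UN_disjoint[OF fin])
    show "\<forall>p\<in>?M. \<forall>p'\<in>?M. p \<noteq> p' \<longrightarrow> ?ext p \<inter> ?ext p' = {}"
    proof (intro ballI impI equals0I)
      fix p p' w assume p: "p \<in> ?M" "p' \<in> ?M" "p \<noteq> p'" and w: "w \<in> ?ext p \<inter> ?ext p'"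
      from w have "prefix p w" "prefix p' w" by (blast intro: prefixI)+
      then have "prefix p p' \<or> prefix p' p" by (rule prefix_same_cases)
      with p show False by (auto simp: minimal_def strict_prefix_def)
    qed
  qed (simp add: len)
  also have "\<dots> = (\<Sum>p\<in>?M. 2 ^ (n - length p))"
    by (intro sum.cong refl, subst card_image) (simp_all add: inj_on_def len)
  finally have "real (card {w. length w = n \<and> Q w}) / 2 ^ n = (\<Sum>p\<in>?M. 2 ^ (n - length p) / 2 ^ n)"
    by (simp only: of_nat_sum of_nat_power of_nat_numeral sum_divide_distrib)
  also have "\<dots> = (\<Sum>p\<in>?M. 1 / 2 ^ length p)"
    by (intro sum.cong refl) (auto simp: power_diff field_simps)
  finally show ?thesis .
qed

text \<open>This trades the sum over minimal programs for fractions of all programs of length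
  \<open>n\<close>; inequalities for \<open>mixture\<close> then follow by counting and passing to
  the limit.\<close>

lemma mixture_limit:
  fixes U :: "('a, 'e) machine"
  shows
      "(\<lambda>n. real (card {p. length p = n \<and> es \<sqsubseteq>\<^sub>o machine_output U p as}) / 2 ^ n)
         \<longlonglongrightarrow> mixture U es as"
proof -
  let ?Q = "\<lambda>p. es \<sqsubseteq>\<^sub>o machine_output U p as"
  let ?M = "\<lambda>n. {p. p \<in> minimal_programs U es as \<and> length p \<le> n}"
  let ?f = "\<lambda>p :: bool list. 1 / 2 ^ length p :: real"
  have dens: "real (card {p. length p = n \<and> ?Q p}) / 2 ^ n = sum ?f (?M n)" for n
    unfolding minimal_programs_def
    by (rule card_extensions_eq_sum_minimal) (rule prefix_of_output_append_program)
  have fin: "finite (?M n)" for n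
    by (rule finite_subset[OF _ finite_lists_length_le[of "UNIV :: bool set" n]]) auto
  have le1: "sum ?f (?M n) \<le> 1" for n
  proof -
    have "card {p. length p = n \<and> ?Q p} \<le> card {p :: bool list. length p = n}"
      using finite_lists_length_eq[of "UNIV :: bool set" n] by (intro card_mono) auto
    also have "\<dots> = 2 ^ n"
      using card_lists_length_eq[of "UNIV :: bool set" n] by simp
    finally have "real (card {p. length p = n \<and> ?Q p}) \<le> 2 ^ n"
      by (metis of_nat_le_iff of_nat_numeral of_nat_power)
    then show ?thesis unfolding dens[symmetric] by simp
  qed
  have cover: "\<exists>n. X \<subseteq> ?M n" if "finite X" "X \<subseteq> minimal_programs U es as" for X
    using that by (intro exI[of _ "Max (length ` X)"]) auto
  \<comment> \<open>\<open>infsum\<close> is 0 by default on a non-summable family. The bound 1 on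
    finite sums, Kraft's inequality, excludes this case.\<close>
  have "?f summable_on minimal_programs U es as"
  proof (rule nonneg_bounded_partial_sums_imp_summable_on)
    show "\<forall>\<^sub>F X in finite_subsets_at_top (minimal_programs U es as). sum ?f X \<le> 1"
    proof (rule eventually_finite_subsets_at_top_weakI)
      fix X assume "finite X" "X \<subseteq> minimal_programs U es as"
      then obtain n where "X \<subseteq> ?M n" using cover by blast
      then have "sum ?f X \<le> sum ?f (?M n)" by (intro sum_mono2 fin) auto
      then show "sum ?f X \<le> 1" using le1[of n] by simp
    qed
  qed simp
  then have "(?f has_sum mixture U es as) (minimal_programs U es as)"
    unfolding mixture_def by (rule has_sum_infsum)
  moreover have "filterlim ?M (finite_subsets_at_top (minimal_programs U es as)) sequentially"
    unfolding filterlim_finite_subsets_at_top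
  proof (intro allI impI)
    fix X assume "finite X \<and> X \<subseteq> minimal_programs U es as"
    then obtain m where m: "X \<subseteq> ?M m" using cover by blast
    show "\<forall>\<^sub>F n in sequentially. finite (?M n) \<and> X \<subseteq> ?M n \<and> ?M n \<subseteq> minimal_programs U es as"
      using eventually_ge_at_top[of m] by eventually_elim (use m fin in auto)
  qed
  ultimately have "(\<lambda>n. sum ?f (?M n)) \<longlonglongrightarrow> mixture U es as"
    unfolding has_sum_def by (rule filterlim_compose)
  then show ?thesis by (simp only: dens)
qed

lemma mixture_nonneg: "0 \<le> mixture U es as"
  by (simp add: mixture_def infsum_nonneg)

text \<open>All extensions of \<open>q\<close> output \<open>es\<close> as well, and they make up
  the fraction \<open>1 / 2 ^ length q\<close> of the programs of length \<open>n\<close>.\<close>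

lemma mixture_lower_bound:
  assumes "es \<sqsubseteq>\<^sub>o machine_output U q as"
  shows "1 / 2 ^ length q \<le> mixture U es as"
proof (rule LIMSEQ_le_const[OF mixture_limit], intro exI allI impI)
  fix n assume n: "length q \<le> n"
  let ?W = "{p. length p = n \<and> es \<sqsubseteq>\<^sub>o machine_output U p as}"
  have fin: "finite ?W"
    by (rule finite_subset[OF _ finite_lists_length_eq[of "UNIV :: bool set" n]]) auto
  have "2 ^ (n - length q) = card ((@) q ` {r :: bool list. length r = n - length q})"
    using card_lists_length_eq[of "UNIV :: bool set" "n - length q"] by (subst card_image) (simp_all add: inj_on_def)
  also have "\<dots> \<le> card ?W"
    using assms n by (intro card_mono fin) (auto intro: prefix_of_output_append_program)
  finally have "2 ^ (n - length q) \<le> real (card ?W)"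
    by (metis of_nat_le_iff of_nat_numeral of_nat_power)
  then show "1 / 2 ^ length q \<le> real (card ?W) / 2 ^ n"
    using n by (simp add: field_simps power_diff)
qed

text \<open>A program outputs at most one continuation of \<open>es\<close>, so the sets counted on
  the left are disjoint, and each lies in the set counted on the right.\<close>

lemma mixture_semimeasure:
  assumes U: "chronological_machine E U" and E: "finite E" and len: "length es = length as"
  shows "(\<Sum>e\<in>E. mixture U (es @ [e]) (as @ [a])) \<le> mixture U es as"
proof (rule LIMSEQ_le[OF tendsto_sum[OF mixture_limit] mixture_limit], intro exI allI impI)
  fix n :: nat
  let ?W = "\<lambda>es as. {p. length p = n \<and> es \<sqsubseteq>\<^sub>o machine_output U p as}"
  have fin: "finite (?W es as)" for es as
    by (rule finite_subset[OF _ finite_lists_length_eq[of "UNIV :: bool set" n]]) auto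
  \<comment> \<open>Chronology enters here: the additional action \<open>a\<close> does not affect
    the first \<open>length as\<close> percepts.\<close>
  have out: "machine_output U p (as @ [a]) i = machine_output U p as i" if "i < length as" for p i
    using U that unfolding chronological_machine_def
    by (metis append_eq_conv_conj)
  have "?W (es @ [e]) (as @ [a]) \<inter> ?W (es @ [e']) (as @ [a]) = {}" if "e \<noteq> e'" for e e'
    using that by (auto simp: prefix_of_output_def dest!: spec[of _ "length es"])
  then have "(\<Sum>e\<in>E. card (?W (es @ [e]) (as @ [a]))) = card (\<Union>e\<in>E. ?W (es @ [e]) (as @ [a]))"
    by (intro card_UN_disjoint[symmetric] E ballI impI fin)
  also have "\<dots> \<le> card (?W es as)"
    using len by (intro card_mono fin)
      (auto simp: prefix_of_output_def out nth_append less_Suc_eq all_conj_distrib imp_conjL split: if_splits)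
  finally have "real (\<Sum>e\<in>E. card (?W (es @ [e]) (as @ [a]))) \<le> real (card (?W es as))"
    by (rule of_nat_mono)
  then show "(\<Sum>e\<in>E. real (card (?W (es @ [e]) (as @ [a]))) / 2 ^ n) \<le> real (card (?W es as)) / 2 ^ n"
    by (simp flip: sum_divide_distrib add: divide_right_mono)
qed

section \<open>Values in semimeasures\<close>

locale discounted_semimeasure =
  fixes E :: "'o percept set" and \<nu> :: "('a, 'o) environment" and \<gamma> :: "nat \<Rightarrow> real"
  assumes finite_percepts: "finite E"
    and rewards: "e \<in> E \<Longrightarrow> 0 \<le> snd e" "e \<in> E \<Longrightarrow> snd e \<le> 1"
    and nonneg: "0 \<le> \<nu> es as"
    and semimeasure:
      "length es = length as \<Longrightarrow> (\<Sum>e\<in>E. \<nu> (es @ [e]) (as @ [a])) \<le> \<nu> es as"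
    and discount: "summable \<gamma>" "0 \<le> \<gamma> k" "0 < discount_tail \<gamma> t"
begin

abbreviation words :: "nat \<Rightarrow> 'o percept list set" where
  "words k \<equiv> {es. set es \<subseteq> E \<and> length es = k}"

definition posterior :: "('a, 'o) policy \<Rightarrow> ('a, 'o) history \<Rightarrow> 'o percept list \<Rightarrow> real" where
  "posterior \<pi> h es =
     \<nu> (map snd h @ es) (map fst h @ policy_actions \<pi> h es) / \<nu> (map snd h) (map fst h)"

definition expected_reward :: "('a, 'o) policy \<Rightarrow> ('a, 'o) history \<Rightarrow> nat \<Rightarrow> real" where
  "expected_reward \<pi> h j = (\<Sum>es\<in>words (j + 1). snd (last es) * posterior \<pi> h es)"

lemma finite_words: "finite (words k)"
  using finite_percepts by (rule finite_lists_length_eq)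

lemma posterior_nonneg: "0 \<le> posterior \<pi> h es"
  by (simp add: posterior_def nonneg)

lemma reward_last:
  assumes "es \<in> words (j + 1)"
  shows "0 \<le> snd (last es)" "snd (last es) \<le> 1"
proof -
  have "last es \<in> E" using assms last_in_set[of es] by (cases es) auto
  then show "0 \<le> snd (last es)" "snd (last es) \<le> 1" by (simp_all add: rewards)
qed

text \<open>Peeling off the first percept matches the recursion of \<open>policy_actions\<close>;
  the remaining word then follows the longer history \<open>?h e\<close>, hence the induction over
  arbitrary \<open>h\<close>.\<close>

lemma sum_words_le:
  "(\<Sum>es\<in>words k. \<nu> (map snd h @ es) (map fst h @ policy_actions \<pi> h es))
     \<le> \<nu> (map snd h) (map fst h)"
proof (induction k arbitrary: h)
  case 0
  have "words 0 = {[]}" by auto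
  then show ?case by simp
next
  case (Suc k)
  let ?h = "\<lambda>e. h @ [(\<pi> h, e)]"
  have "words (Suc k) = (\<lambda>(e, es). e # es) ` (E \<times> words k)"
    by (auto simp: length_Suc_conv)
  then have "(\<Sum>es\<in>words (Suc k). \<nu> (map snd h @ es) (map fst h @ policy_actions \<pi> h es)) =
      (\<Sum>e\<in>E. \<Sum>es\<in>words k. \<nu> (map snd (?h e) @ es) (map fst (?h e) @ policy_actions \<pi> (?h e) es))"
    by (simp add: sum.reindex inj_on_def sum.cartesian_product case_prod_unfold)
  also have "\<dots> \<le> (\<Sum>e\<in>E. \<nu> (map snd (?h e)) (map fst (?h e)))"
    by (intro sum_mono Suc.IH)
  also have "\<dots> \<le> \<nu> (map snd h) (map fst h)"
    by (simp add: semimeasure)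
  finally show ?case .
qed

text \<open>Histories of measure 0 are covered: there \<open>x / 0 = 0\<close> makes every posterior
  vanish.\<close>

lemma sum_posterior_le_1: "(\<Sum>es\<in>words k. posterior \<pi> h es) \<le> 1"
  using sum_words_le[of h \<pi> k] nonneg[of "map snd h" "map fst h"]
  by (auto simp: posterior_def divide_le_eq simp flip: sum_divide_distrib)

lemma expected_reward_nonneg: "0 \<le> expected_reward \<pi> h j"
  unfolding expected_reward_def
  by (intro sum_nonneg mult_nonneg_nonneg posterior_nonneg reward_last)

text \<open>The word \<open>es\<close> earns nothing, and the other words have rewards at most 1 and
  share the remaining posterior mass.\<close>

lemma expected_reward_le:
  assumes "es \<in> words (j + 1)" "snd (last es) = 0"
  shows "expected_reward \<pi> h j \<le> 1 - posterior \<pi> h es"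
proof -
  have "expected_reward \<pi> h j = (\<Sum>es\<in>words (j + 1) - {es}. snd (last es) * posterior \<pi> h es)"
    using assms finite_words by (simp add: expected_reward_def sum.remove[of _ es])
  also have "\<dots> \<le> (\<Sum>es\<in>words (j + 1) - {es}. posterior \<pi> h es)"
    using reward_last by (intro sum_mono mult_left_le_one_le posterior_nonneg) blast+
  also have "\<dots> \<le> 1 - posterior \<pi> h es"
    using sum_posterior_le_1[where k = "j + 1" and \<pi> = \<pi> and h = h] assms(1) finite_words
    by (simp add: sum.remove[of _ es])
  finally show ?thesis .
qed

lemma expected_reward_le_1: "expected_reward \<pi> h j \<le> 1"
proof -
  have "expected_reward \<pi> h j \<le> (\<Sum>es\<in>words (j + 1). posterior \<pi> h es)"
    unfolding expected_reward_def
    using reward_last by (intro sum_mono mult_left_le_one_le posterior_nonneg) blast+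
  then show ?thesis using sum_posterior_le_1 by (rule order_trans)
qed

lemma expected_reward_ge:
  assumes "es \<in> words (j + 1)" "snd (last es) = 1"
  shows "posterior \<pi> h es \<le> expected_reward \<pi> h j"
proof -
  have "snd (last es) * posterior \<pi> h es \<le> expected_reward \<pi> h j"
    unfolding expected_reward_def
    by (intro member_le_sum[OF assms(1)] finite_words mult_nonneg_nonneg posterior_nonneg reward_last) auto
  then show ?thesis using assms(2) by simp
qed

lemma summable_tail: "summable (\<lambda>j. \<gamma> (t + j))"
  using discount(1) by (subst add.commute) (rule summable_ignore_initial_segment)

lemma summable_value: "summable (\<lambda>j. \<gamma> (t + j) * expected_reward \<pi> h j)"
  by (rule summable_comparison_test'[OF summable_tail[of t], where N = 0])
     (simp add: abs_mult discount expected_reward_nonneg expected_reward_le_1 mult_left_le)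

lemma policy_value_eq:
  "policy_value E \<gamma> \<nu> \<pi> h =
     (\<Sum>j. \<gamma> (length h + 1 + j) * expected_reward \<pi> h j) / discount_tail \<gamma> (length h + 1)"
  by (simp add: policy_value_def Let_def expected_reward_def posterior_def)

text \<open>A value is an average of expected rewards with weights
  \<open>\<gamma> (t + j) / discount_tail \<gamma> t\<close> of sum 1, so bounds uniform in
  \<open>j\<close> carry over, here from above and in \<open>policy_value_ge\<close> from
  below.\<close>

lemma policy_value_le:
  assumes "\<And>j. expected_reward \<pi> h j \<le> B"
  shows "policy_value E \<gamma> \<nu> \<pi> h \<le> B"
proof -
  let ?t = "length h + 1"
  have "(\<Sum>j. \<gamma> (?t + j) * expected_reward \<pi> h j) \<le> (\<Sum>j. \<gamma> (?t + j) * B)"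
    by (intro suminf_le summable_value summable_mult2 summable_tail mult_left_mono assms discount)
  also have "\<dots> = discount_tail \<gamma> ?t * B"
    unfolding discount_tail_def by (rule suminf_mult2[symmetric, OF summable_tail])
  finally show ?thesis
    using discount(3)[of ?t] by (simp add: policy_value_eq divide_le_eq mult.commute)
qed

lemma policy_value_ge:
  assumes "\<And>j. B \<le> expected_reward \<pi> h j"
  shows "B \<le> policy_value E \<gamma> \<nu> \<pi> h"
proof -
  let ?t = "length h + 1"
  have "discount_tail \<gamma> ?t * B = (\<Sum>j. \<gamma> (?t + j) * B)"
    unfolding discount_tail_def by (rule suminf_mult2[OF summable_tail])
  also have "\<dots> \<le> (\<Sum>j. \<gamma> (?t + j) * expected_reward \<pi> h j)"
    by (intro suminf_le summable_value summable_mult2 summable_tail mult_left_mono assms discount)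
  finally show ?thesis
    using discount(3)[of ?t] by (simp add: policy_value_eq le_divide_eq mult.commute)
qed

lemma policy_value_le_optimal_value: "policy_value E \<gamma> \<nu> \<pi> h \<le> optimal_value E \<gamma> \<nu> h"
  unfolding optimal_value_def
  by (rule cSUP_upper) (auto intro!: bdd_aboveI2 policy_value_le expected_reward_le_1)

section \<open>Exploiting a predicted policy\<close>

text \<open>The number \<open>w\<close> is the domination constant, and \<open>follow\<close> and
  \<open>deviate\<close> are what domination gives for the two kinds of outcome. In
  \<open>deviate\<close> the later actions \<open>as\<close> are arbitrary, because the reward stays
  1 whatever is done.\<close>

lemma not_optimal_policy_if_exploitable:
  fixes \<pi> :: "('a, 'o) policy"
  assumes e: "(ob0, 0) \<in> E" "(ob1, 1) \<in> E"
  defines "h \<equiv> \<lambda>t. ((\<lambda>h. h @ [(\<pi> h, (ob0, 0))]) ^^ t) []"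
  assumes w: "0 < w"
    and follow: "\<And>t. w \<le> \<nu> (map snd (h t)) (map fst (h t))"
    and deviate: "\<And>t a as. a \<noteq> \<pi> (h t) \<Longrightarrow>
      w \<le> \<nu> (map snd (h t) @ replicate (length as + 1) (ob1, 1)) (map fst (h t) @ a # as)"
    and other: "\<And>b :: 'a. \<exists>a. a \<noteq> b"
  shows "\<not> optimal_policy E \<gamma> \<nu> \<pi>"
proof
  assume opt: "optimal_policy E \<gamma> \<nu> \<pi>"
  define x where "x t = \<nu> (map snd (h t)) (map fst (h t))" for t
  have h_Suc: "h (Suc t) = h t @ [(\<pi> (h t), (ob0, 0))]" for t
    by (simp add: h_def)
  have h_hist: "h t \<in> histories E" for t
    using e(1) by (induction t) (auto simp: h_Suc histories_def, simp add: h_def)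
  \<comment> \<open>Thus the posterior of \<open>k\<close> further zero rewards under
    \<open>\<pi>\<close> is \<open>x (t + k) / x t\<close>.\<close>
  have follow_eq: "map snd (h t) @ replicate k (ob0, 0) = map snd (h (t + k)) \<and>
      map fst (h t) @ policy_actions \<pi> (h t) (replicate k (ob0, 0)) = map fst (h (t + k))" for t k
  proof (induction k arbitrary: t)
    case (Suc k)
    show ?case using Suc[of "Suc t"] by (simp add: h_Suc)
  qed simp
  have x_pos: "0 < x t" for t
    using w follow[of t] by (simp add: x_def)
  have "x (Suc t) \<le> x t" for t
  proof -
    let ?f = "\<lambda>e. \<nu> (map snd (h t) @ [e]) (map fst (h t) @ [\<pi> (h t)])"
    have "?f (ob0, 0) \<le> sum ?f E"
      by (intro member_le_sum e finite_percepts nonneg)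
    also have "\<dots> \<le> x t"
      unfolding x_def by (rule semimeasure) simp
    finally show ?thesis by (simp add: x_def h_Suc)
  qed
  then have "decseq x" by (rule decseq_SucI)
  then obtain L where L: "x \<longlonglongrightarrow> L" "\<And>t. L \<le> x t"
    using decseq_convergent[of x w] follow by (auto simp: x_def)
  have bound: "w + L \<le> x t" for t
  proof -
    have "policy_value E \<gamma> \<nu> \<pi> (h t) \<le> 1 - L / x t"
    proof (rule policy_value_le)
      fix j
      let ?es = "replicate (j + 1) (ob0, 0)"
      have "expected_reward \<pi> (h t) j \<le> 1 - posterior \<pi> (h t) ?es"
        by (rule expected_reward_le) (use e in auto)
      also have "posterior \<pi> (h t) ?es = x (t + (j + 1)) / x t"
        using follow_eq[of t "j + 1"] by (simp only: posterior_def x_def)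
      also have "1 - x (t + (j + 1)) / x t \<le> 1 - L / x t"
        using L(2) x_pos[of t] by (simp add: divide_right_mono)
      finally show "expected_reward \<pi> (h t) j \<le> 1 - L / x t" .
    qed
    moreover obtain a where a: "a \<noteq> \<pi> (h t)" using other by blast
    \<comment> \<open>The constant policy \<open>a\<close> deviates at \<open>h t\<close>, and
      \<open>deviate\<close> applies to whatever it does afterwards.\<close>
    have "w / x t \<le> policy_value E \<gamma> \<nu> (\<lambda>_. a) (h t)"
    proof (rule policy_value_ge)
      fix j
      let ?es = "replicate (j + 1) (ob1, 1 :: real)"
      have acts: "length (policy_actions (\<lambda>_. a) h' es) = length es" for h' es
        by (induction es arbitrary: h') auto
      have "w / x t \<le> posterior (\<lambda>_. a) (h t) ?es"
        using deviate[OF a, of "policy_actions (\<lambda>_. a) (h t @ [(a, (ob1, 1))]) (replicate j (ob1, 1))"]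
          x_pos[of t] by (simp add: posterior_def acts flip: x_def) (simp add: divide_right_mono)
      also have "\<dots> \<le> expected_reward (\<lambda>_. a) (h t) j"
        by (rule expected_reward_ge) (use e in auto)
      finally show "w / x t \<le> expected_reward (\<lambda>_. a) (h t) j" .
    qed
    ultimately have "w / x t \<le> 1 - L / x t"
      using policy_value_le_optimal_value[of "\<lambda>_. a" "h t"] opt h_hist
      by (auto simp: optimal_policy_def)
    then show ?thesis using x_pos[of t] by (simp add: field_simps)
  qed
  \<comment> \<open>The number \<open>w + L\<close> is a lower bound of all \<open>x t\<close>,
    hence of their limit \<open>L\<close>.\<close>
  then have "w + L \<le> L"
    by (intro LIMSEQ_le_const[OF L(1)]) auto
  with w show False by simp
qed

end

section \<open>The adversarial environment\<close>

definition reaches :: "('a, 'e) machine \<Rightarrow> ('a, 'e) mm_config \<Rightarrow> ('a, 'e) mm_config \<Rightarrow> bool" where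
  "reaches M c c' \<longleftrightarrow> (\<exists>n. (mm_step M ^^ n) c = c')"

lemma reaches_refl: "reaches M c c"
  unfolding reaches_def by (rule exI[of _ 0]) simp

lemma reaches_trans [trans]: "reaches M c c' \<Longrightarrow> reaches M c' c'' \<Longrightarrow> reaches M c c''"
  unfolding reaches_def by (metis comp_apply funpow_add)

lemma reaches_step: "mm_step M c = c' \<Longrightarrow> reaches M c c'"
  unfolding reaches_def by (rule exI[of _ 1]) simp

text \<open>A fixed point of \<open>mm_step\<close> arises on halting and also on waiting for input
  beyond its end; in either case nothing more is printed.\<close>

lemma machine_output_of_final_config:
  assumes "reaches M (mm_init M p as) c" "mm_step M c = c"
  shows "machine_output M p as i = (if i < length (mc_output c) then Some (mc_output c ! i) else None)"
proof -
  from assms(1) obtain n where n: "(mm_step M ^^ n) (mm_init M p as) = c"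
    by (auto simp: reaches_def)
  have final: "printed M p as n = mc_output c"
    by (simp add: printed_def n)
  have le: "prefix (printed M p as m) (mc_output c)" for m
  proof -
    have "(mm_step M ^^ k) c = c" for k
      by (induction k) (simp_all add: assms(2))
    then have "printed M p as (m + n) = mc_output c"
      by (simp add: printed_def funpow_add n)
    then show ?thesis using prefix_printed[of m "m + n" M p as] by simp
  qed
  show ?thesis
  proof (cases "i < length (mc_output c)")
    case True
    then show ?thesis
      using final by (auto simp: machine_output_eq_Some_iff intro!: exI[of _ n])
  next
    case False
    then have "\<not> i < length (printed M p as m)" for m
      using prefix_length_le[OF le[of m]] by simp
    then show ?thesis using False by (simp add: machine_output_def)
  qed
qed

section \<open>Tapes seen from the head\<close>

text \<open>Intervals are half-open and relative to the head, here and in \<open>block\<close>, so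
  each head movement shifts both bounds.\<close>

definition blank_outside :: "int \<Rightarrow> int \<Rightarrow> 's tape \<Rightarrow> bool" where
  "blank_outside lo hi t \<longleftrightarrow> (\<forall>i. i < lo \<or> hi \<le> i \<longrightarrow> t i = Blank)"

definition block :: "'s \<Rightarrow> int \<Rightarrow> int \<Rightarrow> 's tape" where
  "block x lo hi = (\<lambda>i. if lo \<le> i \<and> i < hi then Sym x else Blank)"

lemma block_empty: "hi \<le> lo \<Longrightarrow> block x lo hi = (\<lambda>_. Blank)"
  by (auto simp: block_def)

lemma write_move_same_Stay [simp]: "write_move (t 0, Stay) t = t"
  by simp

lemma input_tape_Nil: "input_tape [] = (\<lambda>_. Blank)"
  by (auto simp: input_tape_def)

lemma input_tape_Cons: "input_tape (x # xs) = (\<lambda>i. if i = 0 then Sym x else input_tape xs (i - 1))"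
  by (auto simp: input_tape_def nth_Cons' nat_diff_distrib fun_eq_iff)

lemma input_tape_append: "input_tape (xs @ [x]) = (input_tape xs)(int (length xs) := Sym x)"
  by (auto simp: input_tape_def nth_append fun_eq_iff)

text \<open>The written cell 0 lies in the window and the head moves by at most one cell, so one
  more cell on each side suffices.\<close>

lemma blank_outside_write_move:
  "blank_outside (- int k) (int k + 1) t \<Longrightarrow>
     blank_outside (- int (Suc k)) (int (Suc k) + 1) (write_move (c, d) t)"
  by (cases d) (auto simp: blank_outside_def)


section \<open>The adversary as a function of the actions\<close>

fun adversary :: "('a, 'o) policy \<Rightarrow> 'o percept \<Rightarrow> 'o percept \<Rightarrow> ('a, 'o) history \<Rightarrow> 'a list \<Rightarrow>
    'o percept list" where
  "adversary \<pi> e0 e1 h [] = []"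
| "adversary \<pi> e0 e1 h (a # as) =
     (if a = \<pi> h then e0 # adversary \<pi> e0 e1 (h @ [(a, e0)]) as
      else e1 # replicate (length as) e1)"

lemma length_adversary [simp]: "length (adversary \<pi> e0 e1 h as) = length as"
  by (induction as arbitrary: h) auto

lemma take_adversary: "take n (adversary \<pi> e0 e1 h as) = adversary \<pi> e0 e1 h (take n as)"
proof (induction as arbitrary: h n)
  case (Cons a as)
  then show ?case by (cases n) (auto simp: min_def)
qed simp

lemma adversary_follow:
  fixes \<pi> :: "('a, 'o) policy" and e0 :: "'o percept"
  defines "h \<equiv> \<lambda>t. ((\<lambda>h. h @ [(\<pi> h, e0)]) ^^ t) []"
  shows "adversary \<pi> e0 e1 [] (map fst (h t) @ as) = map snd (h t) @ adversary \<pi> e0 e1 (h t) as"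
  unfolding h_def by (induction t arbitrary: as) simp_all

text \<open>The machine realising the adversary runs \<open>M\<close>, which computes \<open>\<pi>\<close>, on the history before each
  action. Its first tape is the tape of \<open>M\<close>, and its second one stores the history of the obedient
  agent. \<open>M\<close> may leave garbage interspersed with blanks, so the machine cannot see where the garbage
  ends. The third tape therefore counts in unary the copied symbols and the steps of \<open>M\<close>: when it
  holds \<open>k\<close> marks, the tape of \<open>M\<close> is blank further than \<open>k\<close> cells away from the head.\<close>

datatype phase = Run nat | Append_Action | Append_Percept | Obey | Retreat | Sweep_Right | Sweep_Left |
  Copy | Forward | Punish | Await

locale adversary_machine =
  fixes M :: "('a + 'o percept) tm" and E :: "'o percept set" and \<pi> :: "('a, 'o) policy"
    and e0 e1 :: "'o percept"
  assumes wf: "wf_tm M"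
    and percepts: "e0 \<in> E" "e1 \<in> E"
    and alphabet: "h \<in> histories E \<Longrightarrow> Sym ` set (code_history h) \<subseteq> tm_alphabet M"
    and computes: "h \<in> histories E \<Longrightarrow> tm_computes M (code_history h) [Inl (\<pi> h)]"
begin

section \<open>A monotone machine for the adversary\<close>

definition phases :: "phase list" where
  "phases = [Append_Action, Append_Percept, Obey, Retreat, Sweep_Right, Sweep_Left, Copy, Forward,
     Punish, Await]"

text \<open>The states of \<open>M\<close> keep their numbers, so the initial state 0 decodes to
  \<open>Run 0\<close>.\<close>

definition phase_of :: "nat \<Rightarrow> phase" where
  "phase_of s = (if s < tm_states M then Run s else phases ! (s - tm_states M))"

fun state_of :: "phase \<Rightarrow> nat" where
  "state_of (Run q) = q"
| "state_of Append_Action = tm_states M"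
| "state_of Append_Percept = tm_states M + 1"
| "state_of Obey = tm_states M + 2"
| "state_of Retreat = tm_states M + 3"
| "state_of Sweep_Right = tm_states M + 4"
| "state_of Sweep_Left = tm_states M + 5"
| "state_of Copy = tm_states M + 6"
| "state_of Forward = tm_states M + 7"
| "state_of Punish = tm_states M + 8"
| "state_of Await = tm_states M + 9"

text \<open>After an obedient action the history is extended, \<open>Retreat\<close> moves to the
  leftmost cell of the first tape that may be dirty, the sweeps clean that tape, \<open>Copy\<close>
  restores the input from right to left, and \<open>Forward\<close> returns the history head to the
  end. The sweeps are named after the counter head; the work head moves right in both.\<close>

fun phase_instr :: "phase \<Rightarrow> ('a + 'o percept) cell \<Rightarrow> ('a + 'o percept) cell \<Rightarrow>
    ('a + 'o percept) cell \<Rightarrow> ('a, 'o percept) instr" where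
  "phase_instr (Run q) w h c =
     (case tm_delta M q w of
        None \<Rightarrow> ReadAct (\<lambda>a. state_of (if w = Sym (Inl a) then Append_Action else Punish))
      | Some (q', w', d) \<Rightarrow> Work [(w', d), (h, Stay), (Sym (Inr e0), MoveR)] q')"
| "phase_instr Append_Action w h c =
     Work [(w, Stay), (w, MoveR), (c, Stay)] (state_of Append_Percept)"
| "phase_instr Append_Percept w h c =
     Work [(w, Stay), (Sym (Inr e0), MoveR), (c, MoveL)] (state_of Obey)"
| "phase_instr Obey w h c = Emit e0 (state_of Retreat)"
| "phase_instr Retreat w h c =
     (if c = Blank then Work [(Blank, MoveR), (h, Stay), (c, MoveR)] (state_of Sweep_Right)
      else Work [(w, MoveL), (h, Stay), (c, MoveL)] (state_of Retreat))"
| "phase_instr Sweep_Right w h c =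
     (if c = Blank then Work [(w, Stay), (h, Stay), (c, MoveL)] (state_of Sweep_Left)
      else Work [(Blank, MoveR), (h, Stay), (c, MoveR)] (state_of Sweep_Right))"
| "phase_instr Sweep_Left w h c =
     (if c = Blank then Work [(w, Stay), (h, MoveL), (c, Stay)] (state_of Copy)
      else Work [(Blank, MoveR), (h, Stay), (Blank, MoveL)] (state_of Sweep_Left))"
| "phase_instr Copy w h c =
     (if h = Blank then Work [(w, MoveR), (h, MoveR), (c, Stay)] (state_of Forward)
      else Work [(h, MoveL), (h, MoveL), (Sym (Inr e0), MoveR)] (state_of Copy))"
| "phase_instr Forward w h c =
     (if h = Blank then Work [(w, Stay), (h, Stay), (c, Stay)] (state_of (Run 0))
      else Work [(w, Stay), (h, MoveR), (c, Stay)] (state_of Forward))"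
| "phase_instr Punish w h c = Emit e1 (state_of Await)"
| "phase_instr Await w h c = ReadAct (\<lambda>a. state_of Punish)"

definition T :: "('a, 'o percept) machine" where
  "T = \<lparr>mm_tapes = 3, mm_states = tm_states M + length phases, mm_alphabet = tm_alphabet M,
        mm_delta = (\<lambda>s cs. phase_instr (phase_of s) (cs ! 0) (cs ! 1) (cs ! 2))\<rparr>"

fun valid_phase :: "phase \<Rightarrow> bool" where
  "valid_phase (Run q) \<longleftrightarrow> q < tm_states M"
| "valid_phase _ \<longleftrightarrow> True"

lemma phase_of_state_of: "valid_phase ph \<Longrightarrow> phase_of (state_of ph) = ph"
  by (cases ph) (simp_all add: phase_of_def phases_def)

lemma valid_phase_of: "s < tm_states M + length phases \<Longrightarrow> valid_phase (phase_of s)"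
  by (auto simp: phase_of_def phases_def nth_Cons')

lemma tm_delta_wf:
  assumes "q < tm_states M" "c \<in> tm_alphabet M" "tm_delta M q c = Some (q', c', d)"
  shows "q' < tm_states M" "c' \<in> tm_alphabet M"
proof -
  have "case tm_delta M q c of None \<Rightarrow> True
      | Some (q', c', d) \<Rightarrow> q' < tm_states M \<and> c' \<in> tm_alphabet M"
    using wf assms(1,2) unfolding wf_tm_def by blast
  then show "q' < tm_states M" "c' \<in> tm_alphabet M"
    using assms(3) by simp_all
qed

lemma Blank_in_alphabet: "Blank \<in> tm_alphabet M"
  using wf by (simp add: wf_tm_def)

text \<open>The counter mark is the symbol of \<open>e0\<close>, which occurs in the code of a
  one-step history.\<close>

lemma mark_in_alphabet: "Sym (Inr e0) \<in> tm_alphabet M"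
  using alphabet[of "[(undefined, e0)]"] percepts by (simp add: histories_def code_history_def)

lemma wf_T: "wf_machine E T"
  unfolding wf_machine_def
proof (intro conjI allI impI)
  fix s cs assume s: "s < mm_states T" and cs: "length cs = mm_tapes T \<and> set cs \<subseteq> mm_alphabet T"
  then obtain w h c where [simp]: "cs = [w, h, c]"
    by (auto simp: T_def numeral_3_eq_3 length_Suc_conv)
  have in_alph: "w \<in> tm_alphabet M" "h \<in> tm_alphabet M" "c \<in> tm_alphabet M"
    using cs by (simp_all add: T_def)
  have valid: "valid_phase (phase_of s)"
    using s by (intro valid_phase_of) (simp add: T_def)
  have pos: "0 < tm_states M" using wf by (simp add: wf_tm_def)
  show "case mm_delta T s cs of
           Halt \<Rightarrow> True
         | Work ws q' \<Rightarrow> length ws = mm_tapes T \<and> fst ` set ws \<subseteq> mm_alphabet T \<and> q' < mm_states T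
         | ReadBit f \<Rightarrow> (\<forall>b. f b < mm_states T)
         | ReadAct f \<Rightarrow> (\<forall>a. f a < mm_states T)
         | Emit e q' \<Rightarrow> e \<in> E \<and> q' < mm_states T"
  proof (cases "phase_of s")
    case (Run q)
    show ?thesis
    proof (cases "tm_delta M q w")
      case None
      then show ?thesis using Run by (simp add: T_def phases_def)
    next
      case (Some x)
      then obtain q' w' d where x: "tm_delta M q w = Some (q', w', d)" by (cases x) auto
      have "q' < tm_states M" "w' \<in> tm_alphabet M"
        using tm_delta_wf[OF _ in_alph(1) x] valid Run by simp_all
      then show ?thesis using Run x in_alph mark_in_alphabet by (simp add: T_def)
    qed
  qed (use pos percepts in_alph Blank_in_alphabet mark_in_alphabet in \<open>simp_all add: T_def phases_def\<close>)
qed (use wf in \<open>simp_all add: T_def wf_tm_def\<close>)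

section \<open>Simulation of the policy machine\<close>

abbreviation conf :: "bool list \<Rightarrow> phase \<Rightarrow> 'a list \<Rightarrow> ('a + 'o percept) tape \<Rightarrow> ('a + 'o percept) tape \<Rightarrow>
    ('a + 'o percept) tape \<Rightarrow> 'o percept list \<Rightarrow> ('a, 'o percept) mm_config" where
  "conf p ph as w h c out \<equiv> \<lparr>mc_state = state_of ph, mc_program = p, mc_actions = as,
     mc_tapes = [w, h, c], mc_output = out\<rparr>"

abbreviation mark :: "int \<Rightarrow> int \<Rightarrow> ('a + 'o percept) tape" where
  "mark \<equiv> block (Inr e0)"

lemma mm_step_T:
  "valid_phase ph \<Longrightarrow> mm_step T (conf p ph as w h c out) =
     (case phase_instr ph (w 0) (h 0) (c 0) of
        Halt \<Rightarrow> conf p ph as w h c out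
      | Work ws s \<Rightarrow> \<lparr>mc_state = s, mc_program = p, mc_actions = as,
          mc_tapes = map2 write_move ws [w, h, c], mc_output = out\<rparr>
      | ReadBit f \<Rightarrow> (case p of [] \<Rightarrow> conf p ph as w h c out
          | b # p' \<Rightarrow> \<lparr>mc_state = f b, mc_program = p', mc_actions = as,
              mc_tapes = [w, h, c], mc_output = out\<rparr>)
      | ReadAct f \<Rightarrow> (case as of [] \<Rightarrow> conf p ph as w h c out
          | a # as' \<Rightarrow> \<lparr>mc_state = f a, mc_program = p, mc_actions = as',
              mc_tapes = [w, h, c], mc_output = out\<rparr>)
      | Emit e s \<Rightarrow> \<lparr>mc_state = s, mc_program = p, mc_actions = as,
          mc_tapes = [w, h, c], mc_output = out @ [e]\<rparr>)"
  by (simp add: mm_step_def phase_of_state_of)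
     (auto simp: T_def phase_of_state_of split: instr.split list.split)

lemma mark_step:
  "write_move (Sym (Inr e0), MoveR) (mark (- int k) 0) = mark (- int (Suc k)) 0"
  by (auto simp: block_def fun_eq_iff)

text \<open>Each simulated step adds one mark and widens the window by one cell on each side, so the
  marks keep bounding it. The alphabet invariant keeps the states of \<open>M\<close> in range, as
  decoding the phase requires.\<close>

lemma run_reaches:
  assumes "(tm_step M ^^ n) (0, t0) = (q, t)"
    and "blank_outside (- int k) (int k + 1) t0" "range t0 \<subseteq> tm_alphabet M"
  shows "\<exists>k'. reaches T (conf p (Run 0) as t0 h (mark (- int k) 0) out)
                        (conf p (Run q) as t h (mark (- int k') 0) out) \<and>
              blank_outside (- int k') (int k' + 1) t \<and> range t \<subseteq> tm_alphabet M \<and> q < tm_states M"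
  using assms(1)
proof (induction n arbitrary: q t)
  case 0
  then show ?case
    using assms wf by (auto simp: wf_tm_def intro!: exI[of _ k] reaches_refl)
next
  case (Suc n)
  obtain q1 t1 where 1: "(tm_step M ^^ n) (0, t0) = (q1, t1)" by fastforce
  from Suc.IH[OF this] obtain k' where
    r: "reaches T (conf p (Run 0) as t0 h (mark (- int k) 0) out)
                  (conf p (Run q1) as t1 h (mark (- int k') 0) out)" and
    t1: "blank_outside (- int k') (int k' + 1) t1" "range t1 \<subseteq> tm_alphabet M" "q1 < tm_states M"
    by blast
  show ?case
  proof (cases "tm_delta M q1 (t1 0)")
    case None
    then show ?thesis using Suc.prems 1 r t1 by auto
  next
    case (Some x)
    then obtain c d where x: "tm_delta M q1 (t1 0) = Some (q, c, d)" and t: "t = write_move (c, d) t1"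
      using Suc.prems 1 by (cases x) auto
    have new: "q < tm_states M" "c \<in> tm_alphabet M"
      using tm_delta_wf[OF t1(3) _ x] t1(2) by auto
    have "reaches T (conf p (Run q1) as t1 h (mark (- int k') 0) out)
                    (conf p (Run q) as t h (mark (- int (Suc k')) 0) out)"
      by (intro reaches_step, subst mm_step_T)
         (simp_all add: t1 x t mark_step del: write_move.simps of_nat_Suc)
    moreover have "range t \<subseteq> tm_alphabet M"
      using t1(2) new unfolding t by (cases d) auto
    ultimately show ?thesis
      using reaches_trans[OF r] blank_outside_write_move[OF t1(1)] new t by blast
  qed
qed

section \<open>Erasing the tape of the policy machine\<close>

text \<open>There are \<open>m\<close> marks from the left end of the counter up to its head. After
  as many moves the work head is at the left end of the dirty window; the turn erases that cell and
  steps right.\<close>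

lemma retreat_reaches:
  assumes "blank_outside (- int m) b w" "0 < hi"
  shows "\<exists>w'. reaches T (conf p Retreat as w h (mark (1 - int m) hi) out)
                        (conf p Sweep_Right as w' h (mark 0 (hi + int m - 1)) out) \<and>
              blank_outside 0 (b + int m - 1) w'"
  using assms
proof (induction m arbitrary: b hi w)
  case 0
  have tape: "(\<lambda>i. mark 1 hi (i + 1)) = mark 0 (hi - 1)"
    by (auto simp: block_def fun_eq_iff)
  have "mark 1 hi 0 = Blank" by (simp add: block_def)
  then have "reaches T (conf p Retreat as w h (mark 1 hi) out)
      (conf p Sweep_Right as (\<lambda>i. (w(0 := Blank)) (i + 1)) h (mark 0 (hi - 1)) out)"
    by (intro reaches_step, subst mm_step_T) (simp_all add: fun_upd_idem tape)
  moreover have "blank_outside 0 (b - 1) (\<lambda>i. (w(0 := Blank)) (i + 1))"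
    using 0 by (auto simp: blank_outside_def)
  ultimately show ?case by auto
next
  case (Suc m)
  have tape: "(\<lambda>i. mark (- int m) hi (i - 1)) = mark (1 - int m) (hi + 1)"
    by (auto simp: block_def fun_eq_iff)
  have "mark (- int m) hi 0 \<noteq> Blank" using Suc.prems by (simp add: block_def)
  then have step: "reaches T (conf p Retreat as w h (mark (1 - int (Suc m)) hi) out)
      (conf p Retreat as (\<lambda>i. w (i - 1)) h (mark (1 - int m) (hi + 1)) out)"
    by (intro reaches_step, subst mm_step_T) (simp_all add: fun_upd_idem tape)
  have "blank_outside (- int m) (b + 1) (\<lambda>i. w (i - 1))"
    using Suc.prems by (auto simp: blank_outside_def)
  then obtain w' where "reaches T (conf p Retreat as (\<lambda>i. w (i - 1)) h (mark (1 - int m) (hi + 1)) out)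
        (conf p Sweep_Right as w' h (mark 0 (hi + 1 + int m - 1)) out)"
      "blank_outside 0 (b + 1 + int m - 1) w'"
    using Suc.IH[of "b + 1" "\<lambda>i. w (i - 1)" "hi + 1"] Suc.prems by auto
  with reaches_trans[OF step] show ?case
    by (intro exI[of _ w']) (simp add: algebra_simps)
qed

text \<open>The \<open>m\<close> marks from the head on count \<open>m\<close> erased cells and are
  kept for the sweep back.\<close>

lemma sweep_right_reaches:
  assumes "blank_outside 0 b w" "lo \<le> 0"
  shows "\<exists>w'. reaches T (conf p Sweep_Right as w h (mark lo (int m)) out)
                        (conf p Sweep_Left as w' h (mark (lo - int m + 1) 1) out) \<and>
              blank_outside 0 (b - int m) w'"
  using assms
proof (induction m arbitrary: b lo w)
  case 0
  have tape: "(\<lambda>i. mark lo 0 (i - 1)) = mark (lo + 1) 1"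
    by (auto simp: block_def fun_eq_iff)
  have "mark lo 0 0 = Blank" by (simp add: block_def)
  then have "reaches T (conf p Sweep_Right as w h (mark lo 0) out)
      (conf p Sweep_Left as w h (mark (lo + 1) 1) out)"
    by (intro reaches_step, subst mm_step_T) (simp_all add: fun_upd_idem tape)
  then show ?case using 0 by auto
next
  case (Suc m)
  let ?w = "\<lambda>i. (w(0 := Blank)) (i + 1)"
  have tape: "(\<lambda>i. mark lo (int (Suc m)) (i + 1)) = mark (lo - 1) (int m)"
    by (auto simp: block_def fun_eq_iff)
  have "mark lo (int (Suc m)) 0 \<noteq> Blank" using Suc.prems by (simp add: block_def)
  then have step: "reaches T (conf p Sweep_Right as w h (mark lo (int (Suc m))) out)
      (conf p Sweep_Right as ?w h (mark (lo - 1) (int m)) out)"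
    by (intro reaches_step, subst mm_step_T) (simp_all add: fun_upd_idem tape del: of_nat_Suc)
  have "blank_outside 0 (b - 1) ?w"
    using Suc.prems by (auto simp: blank_outside_def)
  then obtain w' where "reaches T (conf p Sweep_Right as ?w h (mark (lo - 1) (int m)) out)
        (conf p Sweep_Left as w' h (mark (lo - 1 - int m + 1) 1) out)"
      "blank_outside 0 (b - 1 - int m) w'"
    using Suc.IH[of "b - 1" ?w "lo - 1"] Suc.prems by auto
  with reaches_trans[OF step] show ?case
    by (intro exI[of _ w']) (simp add: algebra_simps)
qed

text \<open>The marks are used a second time, from right to left, and removed on the way, so work
  tape and counter both end blank.\<close>

lemma sweep_left_reaches:
  assumes "blank_outside 0 (int m) w"
  shows "reaches T (conf p Sweep_Left as w h (mark (1 - int m) 1) out)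
                   (conf p Copy as (\<lambda>_. Blank) (\<lambda>i. h (i - 1)) (\<lambda>_. Blank) out)"
  using assms
proof (induction m arbitrary: w)
  case 0
  have "w = (\<lambda>_. Blank)"
    using 0 by (force simp: blank_outside_def fun_eq_iff)
  then show ?case
    by (intro reaches_step, subst mm_step_T)
       (simp_all add: block_empty fun_upd_idem)
next
  case (Suc m)
  let ?w = "\<lambda>i. (w(0 := Blank)) (i + 1)"
  have tape: "(\<lambda>i. ((mark (- int m) 1)(0 := Blank)) (i - 1)) = mark (1 - int m) 1"
    by (auto simp: block_def fun_eq_iff)
  have "mark (- int m) 1 0 \<noteq> Blank" by (simp add: block_def)
  then have step: "reaches T (conf p Sweep_Left as w h (mark (1 - int (Suc m)) 1) out)
      (conf p Sweep_Left as ?w h (mark (1 - int m) 1) out)"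
    by (intro reaches_step, subst mm_step_T) (simp_all add: tape[simplified])
  have "blank_outside 0 (int m) ?w"
    using Suc.prems by (auto simp: blank_outside_def)
  from reaches_trans[OF step Suc.IH[OF this]] show ?case .
qed

section \<open>Restoring the input from the stored history\<close>

definition history_tape :: "('a + 'o percept) list \<Rightarrow> int \<Rightarrow> ('a + 'o percept) tape" where
  "history_tape x j = (\<lambda>i. input_tape x (i + j))"

lemma history_tape_left: "(\<lambda>i. history_tape x j (i - 1)) = history_tape x (j - 1)"
  by (simp add: history_tape_def algebra_simps)

lemma history_tape_right: "(\<lambda>i. history_tape x j (i + 1)) = history_tape x (j + 1)"
  by (simp add: history_tape_def algebra_simps)

lemma history_tape_append:
  "write_move (Sym a, MoveR) (history_tape x (int (length x))) =
     history_tape (x @ [a]) (int (length (x @ [a])))"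
  by (auto simp: history_tape_def input_tape_append fun_eq_iff algebra_simps)

text \<open>Here \<open>m\<close> symbols remain to be copied, and the work head is just left of
  those already written. Copying leftwards ends at the first symbol, where \<open>M\<close> has to
  start, and one mark per symbol bounds the new input.\<close>

lemma copy_reaches:
  assumes "m \<le> length x"
  shows "reaches T (conf p Copy as (\<lambda>i. input_tape (drop m x) (i - 1)) (history_tape x (int m - 1))
                     (mark (- int k) 0) out)
                   (conf p Forward as (input_tape x) (history_tape x 0) (mark (- int (k + m)) 0) out)"
  using assms
proof (induction m arbitrary: k)
  case 0
  have "history_tape x (- 1) 0 = Blank"
    by (simp add: history_tape_def input_tape_def)
  then show ?case
    by (intro reaches_step, subst mm_step_T)
       (simp_all add: fun_upd_idem history_tape_right)
next
  case (Suc m)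
  let ?w = "\<lambda>i. input_tape (drop (Suc m) x) (i - 1)"
  have h: "history_tape x (int m) 0 = Sym (x ! m)"
    using Suc.prems by (simp add: history_tape_def input_tape_def)
  have w: "(\<lambda>i. (?w(0 := Sym (x ! m))) (i - 1)) = (\<lambda>i. input_tape (drop m x) (i - 1))"
    using Suc.prems by (auto simp: Cons_nth_drop_Suc[symmetric] input_tape_Cons fun_eq_iff)
  have "reaches T (conf p Copy as ?w (history_tape x (int (Suc m) - 1)) (mark (- int k) 0) out)
      (conf p Copy as (\<lambda>i. input_tape (drop m x) (i - 1)) (history_tape x (int m - 1))
        (mark (- int (Suc k)) 0) out)"
    by (intro reaches_step, subst mm_step_T)
       (simp_all add: h w[simplified] fun_upd_idem history_tape_left mark_step[simplified])
  then show ?case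
    using Suc.IH[of "Suc k"] Suc.prems by (auto elim!: reaches_trans)
qed

lemma forward_reaches:
  assumes "n + m = length x"
  shows "reaches T (conf p Forward as w (history_tape x (int n)) c out)
                   (conf p (Run 0) as w (history_tape x (int (length x))) c out)"
  using assms
proof (induction m arbitrary: n)
  case 0
  have "history_tape x (int n) 0 = Blank"
    using 0 by (simp add: history_tape_def input_tape_def)
  moreover have "valid_phase (Run 0)"
    using wf by (simp add: wf_tm_def)
  ultimately show ?case
    using 0 by (intro reaches_step, subst mm_step_T) (simp_all add: fun_upd_idem)
next
  case (Suc m)
  have "history_tape x (int n) 0 \<noteq> Blank"
    using Suc.prems by (simp add: history_tape_def input_tape_def)
  then have "reaches T (conf p Forward as w (history_tape x (int n)) c out)
      (conf p Forward as w (history_tape x (int (Suc n))) c out)"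
    by (intro reaches_step, subst mm_step_T) (simp_all add: fun_upd_idem history_tape_right add.commute)
  then show ?case
    using Suc.IH[of "Suc n"] Suc.prems by (auto elim!: reaches_trans)
qed

section \<open>One round of the machine and its complete output\<close>

abbreviation ready :: "bool list \<Rightarrow> ('a, 'o) history \<Rightarrow> 'a list \<Rightarrow> 'o percept list \<Rightarrow>
    ('a, 'o percept) mm_config" where
  "ready p h as out \<equiv> conf p (Run 0) as (input_tape (code_history h))
     (history_tape (code_history h) (int (length (code_history h))))
     (mark (- int (length (code_history h))) 0) out"

text \<open>The dirty window has \<open>2 * k + 1\<close> cells: the turn at the end of
  \<open>Retreat\<close> erases one, and each sweep erases \<open>k\<close>.\<close>

lemma prepare_reaches:
  assumes "blank_outside (- int k) (int k + 1) w" and x: "x = code_history h"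
  shows "reaches T (conf p Retreat as w (history_tape x (int (length x))) (mark (1 - int k) 1) out)
                   (ready p h as out)"
proof -
  let ?H = "history_tape x (int (length x))"
  from retreat_reaches[OF assms(1), of 1 p as ?H out] obtain w1 where
    1: "reaches T (conf p Retreat as w ?H (mark (1 - int k) 1) out)
        (conf p Sweep_Right as w1 ?H (mark 0 (int k)) out)" "blank_outside 0 (2 * int k) w1"
    by auto
  note 1(1)
  also from sweep_right_reaches[OF 1(2), of 0 p as ?H k out] obtain w2 where
    2: "reaches T (conf p Sweep_Right as w1 ?H (mark 0 (int k)) out)
          (conf p Sweep_Left as w2 ?H (mark (1 - int k) 1) out)" "blank_outside 0 (int k) w2"
    by (auto simp: algebra_simps)
  note 2(1)
  also note sweep_left_reaches[OF 2(2)]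
  also have "conf p Copy as (\<lambda>_. Blank) (\<lambda>i. ?H (i - 1)) (\<lambda>_. Blank) out =
      conf p Copy as (\<lambda>i. input_tape (drop (length x) x) (i - 1))
        (history_tape x (int (length x) - 1)) (mark (- int 0) 0) out"
    by (simp add: history_tape_left block_empty input_tape_Nil)
  also note copy_reaches[OF order_refl]
  also have "reaches T (conf p Forward as (input_tape x) (history_tape x 0) (mark (- int (0 + length x)) 0) out)
      (ready p h as out)"
    using forward_reaches[of 0 "length x" x] by (simp add: x)
  finally show ?thesis .
qed

lemma ready_reaches_decision:
  assumes "h \<in> histories E" and x: "x = code_history h"
  shows "\<exists>k q w. reaches T (ready p h as out)
            (conf p (Run q) as w (history_tape x (int (length x))) (mark (- int k) 0) out) \<and>
          q < tm_states M \<and> w 0 = Sym (Inl (\<pi> h)) \<and> tm_delta M q (w 0) = None \<and>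
          blank_outside (- int k) (int k + 1) w"
proof -
  from computes[OF assms(1)] obtain n q w where
    n: "(tm_step M ^^ n) (0, input_tape x) = (q, w)" "tm_delta M q (w 0) = None" "w 0 = Sym (Inl (\<pi> h))"
    by (auto simp: tm_computes_def x)
  have "blank_outside (- int (length x)) (int (length x) + 1) (input_tape x)"
    by (auto simp: blank_outside_def input_tape_def)
  moreover have "range (input_tape x) \<subseteq> tm_alphabet M"
    using alphabet[OF assms(1)] Blank_in_alphabet by (auto simp: input_tape_def x)
  ultimately obtain k where
    "reaches T (ready p h as out)
       (conf p (Run q) as w (history_tape x (int (length x))) (mark (- int k) 0) out)"
    "blank_outside (- int k) (int k + 1) w" "q < tm_states M"
    using run_reaches[OF n(1), of "length x" p as "history_tape x (int (length x))" out]
    unfolding x by metis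
  with n show ?thesis by (intro exI conjI) assumption+
qed

lemma obey_reaches:
  assumes "h \<in> histories E"
  shows "reaches T (ready p h (\<pi> h # as) out) (ready p (h @ [(\<pi> h, e0)]) as (out @ [e0]))"
proof -
  define x where "x = code_history h"
  define y where "y = code_history (h @ [(\<pi> h, e0)])"
  have y: "y = (x @ [Inl (\<pi> h)]) @ [Inr e0]"
    by (simp add: x_def y_def code_history_def)
  from ready_reaches_decision[OF assms x_def] obtain k q w where
    r: "reaches T (ready p h (\<pi> h # as) out)
            (conf p (Run q) (\<pi> h # as) w (history_tape x (int (length x))) (mark (- int k) 0) out)" and
    q: "q < tm_states M" "w 0 = Sym (Inl (\<pi> h))" "tm_delta M q (w 0) = None" and
    w: "blank_outside (- int k) (int k + 1) w"
    by metis
  have c: "(\<lambda>i. mark (- int k) 0 (i - 1)) = mark (1 - int k) 1"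
    by (auto simp: block_def fun_eq_iff)
  let ?x = "x @ [Inl (\<pi> h)]"
  note r
  also have "reaches T (conf p (Run q) (\<pi> h # as) w (history_tape x (int (length x))) (mark (- int k) 0) out)
      (conf p Append_Action as w (history_tape x (int (length x))) (mark (- int k) 0) out)"
    using q by (intro reaches_step, subst mm_step_T) simp_all
  also have "reaches T \<dots>
      (conf p Append_Percept as w (history_tape ?x (int (length ?x))) (mark (- int k) 0) out)"
    using q by (intro reaches_step, subst mm_step_T)
      (simp_all add: fun_upd_idem history_tape_append[simplified])
  \<comment> \<open>The counter head steps back from the blank behind the marks onto the last mark,
    if there is one; \<open>Retreat\<close> starts from there.\<close>
  also have "reaches T \<dots> (conf p Obey as w (history_tape y (int (length y))) (mark (1 - int k) 1) out)"
    using history_tape_append[of "Inr e0" ?x]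
    by (intro reaches_step, subst mm_step_T) (simp_all add: y fun_upd_idem c)
  also have "reaches T \<dots>
      (conf p Retreat as w (history_tape y (int (length y))) (mark (1 - int k) 1) (out @ [e0]))"
    by (intro reaches_step, subst mm_step_T) simp_all
  also note prepare_reaches[OF w y_def]
  finally show ?thesis .
qed

lemma await_reaches:
  "reaches T (conf p Await as w h c out) (conf p Await [] w h c (out @ replicate (length as) e1))"
proof (induction as arbitrary: out)
  case (Cons a as)
  have "reaches T (conf p Await (a # as) w h c out) (conf p Punish as w h c out)"
    by (intro reaches_step, subst mm_step_T) simp_all
  also have "reaches T \<dots> (conf p Await as w h c (out @ [e1]))"
    by (intro reaches_step, subst mm_step_T) simp_all
  also note Cons.IH
  finally show ?case by simp
qed (simp add: reaches_refl)

text \<open>Agreement with \<open>\<pi>\<close> completes a round, and a deviation leads into the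
  loop of \<open>Punish\<close> and \<open>Await\<close>. Once the actions are exhausted,
  \<open>T\<close> blocks in \<open>ReadAct\<close>, which is a fixed point of
  \<open>mm_step\<close>.\<close>

lemma ready_reaches_final:
  assumes "h \<in> histories E"
  shows "\<exists>c. reaches T (ready p h as out) c \<and> mm_step T c = c \<and>
             mc_output c = out @ adversary \<pi> e0 e1 h as"
  using assms
proof (induction as arbitrary: h out)
  case Nil
  from ready_reaches_decision[OF Nil refl, of p "[]" out] obtain k q w where
    "reaches T (ready p h [] out)
       (conf p (Run q) [] w (history_tape (code_history h) (int (length (code_history h))))
         (mark (- int k) 0) out)"
    "q < tm_states M" "tm_delta M q (w 0) = None"
    by metis
  then show ?case by (intro exI conjI) (assumption, subst mm_step_T, simp_all)
next
  case (Cons a as)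
  show ?case
  proof (cases "a = \<pi> h")
    case True
    have "h @ [(a, e0)] \<in> histories E"
      using Cons.prems percepts by (simp add: histories_def)
    from Cons.IH[OF this, of "out @ [e0]"] obey_reaches[OF Cons.prems, of p as out] True
    show ?thesis by (auto intro: reaches_trans)
  next
    case False
    from ready_reaches_decision[OF Cons.prems refl, of p "a # as" out] obtain k q w H where
      r: "reaches T (ready p h (a # as) out) (conf p (Run q) (a # as) w H (mark (- int k) 0) out)" and
      q: "q < tm_states M" "w 0 = Sym (Inl (\<pi> h))" "tm_delta M q (w 0) = None"
      by metis
    note r
    also have "reaches T (conf p (Run q) (a # as) w H (mark (- int k) 0) out)
        (conf p Punish as w H (mark (- int k) 0) out)"
      using q False by (intro reaches_step, subst mm_step_T) simp_all
    also have "reaches T \<dots> (conf p Await as w H (mark (- int k) 0) (out @ [e1]))"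
      by (intro reaches_step, subst mm_step_T) simp_all
    also note await_reaches
    finally show ?thesis
      using False by (intro exI conjI) (assumption, subst mm_step_T, simp_all)
  qed
qed

lemma machine_output_T:
  "machine_output T p as i = (if i < length as then Some (adversary \<pi> e0 e1 [] as ! i) else None)"
proof -
  \<comment> \<open>The code of the empty history has no symbols, so the blank initial tapes already
    form the start of a round.\<close>
  have "mm_init T p as = ready p [] as []"
    by (simp add: mm_init_def T_def code_history_def numeral_3_eq_3 history_tape_def
        input_tape_Nil block_empty)
  moreover have "[] \<in> histories E" by (simp add: histories_def)
  ultimately obtain c where "reaches T (mm_init T p as) c" "mm_step T c = c"
      "mc_output c = adversary \<pi> e0 e1 [] as"
    using ready_reaches_final[of "[]" p as "[]"] by auto
  then show ?thesis using machine_output_of_final_config by fastforce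
qed

lemma chronological_T: "chronological_machine E T"
  unfolding chronological_machine_def machine_output_T
  by (auto simp: wf_T simp flip: take_adversary)

lemma prefix_of_output_T: "adversary \<pi> e0 e1 [] as \<sqsubseteq>\<^sub>o machine_output T p as"
  by (simp add: prefix_of_output_def machine_output_T)

end

section \<open>Optimal policies are not computable\<close>

theorem theorem6p15:
  fixes E :: "'o percept set"
    and \<gamma> :: "nat \<Rightarrow> real"
    and U :: "('a::finite, 'o percept) machine"
  assumes "2 \<le> CARD('a)"
    and "finite E"
    and "\<forall>(ob, r) \<in> E. 0 \<le> r \<and> r \<le> 1"
    and "\<exists>ob. (ob, 0) \<in> E"
    and "\<exists>ob. (ob, 1) \<in> E"
    and "\<forall>k. 0 \<le> \<gamma> k"
    and "computable_real_seq \<gamma>"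
    and "summable \<gamma>"
    and "\<forall>t. 0 < discount_tail \<gamma> t"
    and "universal_machine E U"
  shows "\<forall>\<pi>. AIXI E \<gamma> U \<pi> \<longrightarrow> \<not> computable_policy E \<pi>"
proof (intro allI impI notI)
  fix \<pi> :: "('a, 'o) policy"
  assume opt: "AIXI E \<gamma> U \<pi>" and "computable_policy E \<pi>"
  then obtain M where M: "wf_tm M"
      "\<And>h. h \<in> histories E \<Longrightarrow> Sym ` set (code_history h) \<subseteq> tm_alphabet M"
      "\<And>h. h \<in> histories E \<Longrightarrow> tm_computes M (code_history h) [Inl (\<pi> h)]"
    unfolding computable_policy_def turing_computable_on_def by auto
  obtain ob0 ob1 where ob: "(ob0, 0) \<in> E" "(ob1, 1) \<in> E" using assms(4,5) by auto
  interpret adversary_machine M E \<pi> "(ob0, 0)" "(ob1, 1)"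
    by unfold_locales (use M ob in auto)
  have U: "chronological_machine E U"
    using assms(10) by (simp add: universal_machine_def)
  interpret discounted_semimeasure E "mixture U" \<gamma>
  proof
    show "summable \<gamma>" "0 \<le> \<gamma> k" "0 < discount_tail \<gamma> t" for k t
      using assms(6,8,9) by auto
  qed (use assms(2,3) in \<open>auto intro: mixture_nonneg mixture_semimeasure[OF U]\<close>)
  obtain q where q: "machine_output U (q @ p) as = machine_output T p as" for p as
    using assms(10) chronological_T unfolding universal_machine_def by metis
  let ?env = "adversary \<pi> (ob0, 0) (ob1, 1) []"
  \<comment> \<open>The output of \<open>T\<close> is the same for every program, so
    \<open>q\<close> followed by the empty program already prints the answers of the adversary to
    any actions. This yields the domination constant.\<close>
  have w: "1 / 2 ^ length q \<le> mixture U (?env as) as" for as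
    by (rule mixture_lower_bound) (use q[of "[]"] prefix_of_output_T in auto)
  have other: "\<exists>a. a \<noteq> b" for b :: 'a
  proof (rule ccontr)
    assume "\<nexists>a. a \<noteq> b"
    then have "(UNIV :: 'a set) = {b}" by auto
    from arg_cong[OF this, of card] assms(1) show False by simp
  qed
  let ?h = "\<lambda>t. ((\<lambda>h. h @ [(\<pi> h, (ob0, 0))]) ^^ t) []"
  have "\<not> optimal_policy E \<gamma> (mixture U) \<pi>"
  proof (rule not_optimal_policy_if_exploitable[where w = "1 / 2 ^ length q"])
    show "1 / 2 ^ length q \<le> mixture U (map snd (?h t)) (map fst (?h t))" for t
      using w[of "map fst (?h t)"] adversary_follow[of \<pi> "(ob0, 0)" "(ob1, 1)" t "[]"] by simp
    \<comment> \<open>The adversary answers \<open>a\<close> and each action in \<open>as\<close> by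
      \<open>(ob1, 1)\<close>, hence \<open>length as + 1\<close> copies.\<close>
    show "1 / 2 ^ length q \<le> mixture U (map snd (?h t) @ replicate (length as + 1) (ob1, 1))
        (map fst (?h t) @ a # as)" if "a \<noteq> \<pi> (?h t)" for t a as
      using w[of "map fst (?h t) @ a # as"] that
      by (simp add: adversary_follow)
  qed (use ob other in simp_all)
  with opt show False by (simp add: AIXI_def)
qed

end
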